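(* Let $g,d,y\in\mathbb{R}^n$, $\alpha>0$, $s=\alpha d$, and suppose $d^\top y>0$. Let $\mathcal T=tI+\nu\,yy^\top$ with $(t,\nu)=\left(0,\frac{1}{s^\top y}\right)$. Then the Matrix Dai--Liao search direction $$-g+\frac{g^\top y}{d^\top y}\,d-\frac{g^\top s}{d^\top y}\,\mathcal T d$$ is equal to the Zhang--Zhou--Li three-term conjugate gradient direction $$-g+\frac{g^\top y}{d^\top y}\,d-\frac{g^\top d}{d^\top y}\,y.$$
   Context: $I$ is the $n\times n$ identity. In a conjugate gradient iteration, $g=\nabla f(x_{k+1})$ is the new gradient, $d=d_k$ the previous search direction, $\alpha=\alpha_k$ the step size, $s=x_{k+1}-x_k=\alpha d$ the step, and $y=\nabla f(x_{k+1})-\nabla f(x_k)$; the Wolfe line search guarantees $d^\top y>0$. *)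

theory Defs
  imports "HOL-Analysis.Analysis"
begin

(* The matrix y y^T. The library types of columnvector and rowvector leave the other
   dimension free, so the annotations fixing it to 1 are essential. *)
definition outer_square :: "real ^ 'n \<Rightarrow> real ^ 'n ^ 'n" where
  "outer_square y = (columnvector y :: real ^ 1 ^ 'n) ** (rowvector y :: real ^ 'n ^ 1)"

(* g: new gradient, d: previous direction, s: step, y: gradient difference,
   T: the matrix parameter replacing the scalar Dai--Liao parameter. *)
definition matrix_dai_liao_dir ::
    "real ^ 'n \<Rightarrow> real ^ 'n \<Rightarrow> real ^ 'n \<Rightarrow> real ^ 'n \<Rightarrow> real ^ 'n ^ 'n \<Rightarrow> real ^ 'n" where
  "matrix_dai_liao_dir g d s y T =
     - g + ((g \<bullet> y) / (d \<bullet> y)) *\<^sub>R d - ((g \<bullet> s) / (d \<bullet> y)) *\<^sub>R (T *v d)"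

definition zhang_zhou_li_dir ::
    "real ^ 'n \<Rightarrow> real ^ 'n \<Rightarrow> real ^ 'n \<Rightarrow> real ^ 'n" where
  "zhang_zhou_li_dir g d y =
     - g + ((g \<bullet> y) / (d \<bullet> y)) *\<^sub>R d - ((g \<bullet> d) / (d \<bullet> y)) *\<^sub>R y"

end

theory Submission
  imports Defs
begin

text \<open>The rank-one matrix \<open>outer_square y\<close> sends every vector to a multiple of
  \<open>y\<close> (\<open>outer_square_mult_vector\<close>). Since \<open>t = 0\<close>,
  \<open>T *v d\<close> is therefore parallel to \<open>y\<close>, and the choice of
  \<open>\<nu>\<close> normalises it to \<open>y\<close> divided by \<open>\<alpha>\<close>. The
  step length hidden in \<open>g \<bullet> s\<close> then cancels this factor.\<close>

lemma outer_square_mult_vector: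
  fixes y v :: "real ^ 'n"
  shows "outer_square y *v v = (v \<bullet> y) *\<^sub>R y"
  by (simp add: vec_eq_iff outer_square_def columnvector_def rowvector_def matrix_matrix_mult_def
      matrix_vector_mult_def inner_vec_def sum_distrib_left mult_ac)

theorem mainTheorem7:
  fixes g d y s :: "real ^ 'n"
    and \<alpha> t \<nu> :: real
    and T :: "real ^ 'n ^ 'n"
  assumes "\<alpha> > 0"
    and "s = \<alpha> *\<^sub>R d"
    and "d \<bullet> y > 0"
    and "T = t *\<^sub>R mat 1 + \<nu> *\<^sub>R outer_square y"
    and "(t, \<nu>) = (0, 1 / (s \<bullet> y))"
  shows "matrix_dai_liao_dir g d s y T = zhang_zhou_li_dir g d y"
proof -
  have "T *v d = (1 / (s \<bullet> y)) *\<^sub>R (outer_square y *v d)"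
    using assms(4,5) by (simp add: scaleR_matrix_vector_assoc)
  \<comment> \<open>The coefficient is \<open>(d \<bullet> y) / (s \<bullet> y)\<close> with
    \<open>s \<bullet> y = \<alpha> * (d \<bullet> y)\<close>; the curvature condition makes
    \<open>d \<bullet> y\<close> nonzero, so it cancels.\<close>
  also have "\<dots> = (1 / \<alpha>) *\<^sub>R y"
    using assms(1-3) by (simp add: outer_square_mult_vector)
  \<comment> \<open>Here \<open>g \<bullet> s = \<alpha> * (g \<bullet> d)\<close> absorbs
    \<open>1 / \<alpha>\<close>, as \<open>\<alpha>\<close> is nonzero.\<close>
  finally show ?thesis
    using assms(1,2) by (simp add: matrix_dai_liao_dir_def zhang_zhou_li_dir_def)
qed

end
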